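(* Let $(G,c)$ be an infinite resistance network with vertex set $G^0$. Then $(G,R^F)$ may be isometrically embedded in a Hilbert space, in the sense that there exist a Hilbert space $\mathcal{H}$ and a map $w:G^0\to\mathcal{H}$, $x\mapsto w_x$, such that $R^F(x,y)^{1/2}=\|w_x-w_y\|_{\mathcal{H}}$ for all vertices $x,y$.
   Context: A resistance network $(G,c)$ is a connected graph with vertex set $G^0$ and a conductance function $c:G^0\times G^0\to[0,\infty)$ with $c_{xy}=c_{yx}$, $c_{xx}=0$, where $x\sim y$ iff $c_{xy}>0$, and $c(x):=\sum_{y\sim x}c_{xy}<\infty$ for every vertex $x$ (vertices of infinite degree are allowed). Connected means that any two vertices are joined by a finite path of edges. The Laplacian is $(\Delta v)(x)=\sum_{y\sim x}c_{xy}(v(x)-v(y))$. On a finite network $H$, the effective resistance is $R_H(x,y)=v(x)-v(y)$, where $v$ is any solution of $\Delta v=\delta_x-\delta_y$ on $H$ ($\delta_x$ is the indicator function of $\{x\}$). An exhaustion $\{G_k\}$ of $G$ is an increasing sequence of finite connected full subgraphs with union $G$ (full: containing all edges of $G$ between its vertices, with the same conductances); $G_k^F$ denotes this full subnetwork. The free resistance is $R^F(x,y):=\lim_{k\to\infty}R_{G_k^F}(x,y)$ for any exhaustion with $x,y\in G_k$ for all $k$ (the limit does not depend on the exhaustion). *)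

theory Defs
  imports "HOL-Analysis.Analysis"
begin

section \<open>Resistance networks\<close>

text \<open>
  A network is given by its vertex set \<open>V\<close> and a conductance function \<open>c\<close>. Values of \<open>c\<close> outside
  \<open>V \<times> V\<close> are never used, so that for \<open>W \<subseteq> V\<close> the full subnetwork on \<open>W\<close> is the pair of \<open>W\<close>
  and the same \<open>c\<close>.
\<close>

definition nbrs :: "'a set \<Rightarrow> ('a \<Rightarrow> 'a \<Rightarrow> real) \<Rightarrow> 'a \<Rightarrow> 'a set" where
  "nbrs V c x = {y \<in> V. c x y > 0}"

definition connected_network :: "'a set \<Rightarrow> ('a \<Rightarrow> 'a \<Rightarrow> real) \<Rightarrow> bool" where
  "connected_network V c \<longleftrightarrow>
     (\<forall>x\<in>V. \<forall>y\<in>V. (x, y) \<in> {(a, b). a \<in> V \<and> b \<in> nbrs V c a}\<^sup>*)"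

locale resistance_network =
  fixes V :: "'a set" and c :: "'a \<Rightarrow> 'a \<Rightarrow> real"
  assumes conductance_nonneg: "\<And>x y. x \<in> V \<Longrightarrow> y \<in> V \<Longrightarrow> 0 \<le> c x y"
    and conductance_sym: "\<And>x y. x \<in> V \<Longrightarrow> y \<in> V \<Longrightarrow> c x y = c y x"
    and conductance_diag: "\<And>x. x \<in> V \<Longrightarrow> c x x = 0"
    and conductance_summable: "\<And>x. x \<in> V \<Longrightarrow> c x summable_on nbrs V c x"
    and connected: "connected_network V c"

definition laplacian :: "'a set \<Rightarrow> ('a \<Rightarrow> 'a \<Rightarrow> real) \<Rightarrow> ('a \<Rightarrow> real) \<Rightarrow> 'a \<Rightarrow> real" where
  "laplacian V c v x = (\<Sum>\<^sub>\<infinity>y\<in>nbrs V c x. c x y * (v x - v y))"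

text \<open>For a finite connected network, the value does not depend on the solution \<open>v\<close>.\<close>

definition effective_resistance :: "'a set \<Rightarrow> ('a \<Rightarrow> 'a \<Rightarrow> real) \<Rightarrow> 'a \<Rightarrow> 'a \<Rightarrow> real" where
  "effective_resistance H c x y =
     (THE r. \<exists>v. (\<forall>z\<in>H. laplacian H c v z = indicator {x} z - indicator {y} z) \<and> r = v x - v y)"

definition exhaustion :: "'a set \<Rightarrow> ('a \<Rightarrow> 'a \<Rightarrow> real) \<Rightarrow> (nat \<Rightarrow> 'a set) \<Rightarrow> bool" where
  "exhaustion V c G \<longleftrightarrow>
     (\<forall>k. finite (G k) \<and> connected_network (G k) c) \<and> incseq G \<and> (\<Union>k. G k) = V"

text \<open>The common limit along all exhaustions by finite full subnetworks containing \<open>x\<close> and \<open>y\<close>.\<close>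

definition free_resistance :: "'a set \<Rightarrow> ('a \<Rightarrow> 'a \<Rightarrow> real) \<Rightarrow> 'a \<Rightarrow> 'a \<Rightarrow> real" where
  "free_resistance V c x y =
     (THE r. \<forall>G. exhaustion V c G \<and> (\<forall>k. x \<in> G k \<and> y \<in> G k)
        \<longrightarrow> (\<lambda>k. effective_resistance (G k) c x y) \<longlonglongrightarrow> r)"

section \<open>Hilbert spaces with an explicit carrier\<close>

text \<open>
  Existence of a Hilbert space cannot be expressed by quantifying over types of class
  \<open>{real_inner, complete_space}\<close>, so real Hilbert spaces are described here as structures on a
  carrier set. Lemma \<open>hilbert_space_UNIV\<close> below relates the two notions.
\<close>

record 'h inner_product_structure =
  points :: "'h set"
  vzero :: 'h
  vadd :: "'h \<Rightarrow> 'h \<Rightarrow> 'h"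
  vscale :: "real \<Rightarrow> 'h \<Rightarrow> 'h"
  vinner :: "'h \<Rightarrow> 'h \<Rightarrow> real"

definition vdiff :: "'h inner_product_structure \<Rightarrow> 'h \<Rightarrow> 'h \<Rightarrow> 'h" where
  "vdiff H u v = vadd H u (vscale H (- 1) v)"

definition vnorm :: "'h inner_product_structure \<Rightarrow> 'h \<Rightarrow> real" where
  "vnorm H u = sqrt (vinner H u u)"

locale hilbert_space =
  fixes H :: "'h inner_product_structure"
  assumes zero_closed: "vzero H \<in> points H"
    and add_closed: "\<And>u v. u \<in> points H \<Longrightarrow> v \<in> points H \<Longrightarrow> vadd H u v \<in> points H"
    and scale_closed: "\<And>a u. u \<in> points H \<Longrightarrow> vscale H a u \<in> points H"
    and add_assoc: "\<And>u v w. u \<in> points H \<Longrightarrow> v \<in> points H \<Longrightarrow> w \<in> points H \<Longrightarrow>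
      vadd H (vadd H u v) w = vadd H u (vadd H v w)"
    and add_commute: "\<And>u v. u \<in> points H \<Longrightarrow> v \<in> points H \<Longrightarrow> vadd H u v = vadd H v u"
    and add_zero: "\<And>u. u \<in> points H \<Longrightarrow> vadd H u (vzero H) = u"
    and add_inverse: "\<And>u. u \<in> points H \<Longrightarrow> \<exists>v\<in>points H. vadd H u v = vzero H"
    and scale_add_right: "\<And>a u v. u \<in> points H \<Longrightarrow> v \<in> points H \<Longrightarrow>
      vscale H a (vadd H u v) = vadd H (vscale H a u) (vscale H a v)"
    and scale_add_left: "\<And>a b u. u \<in> points H \<Longrightarrow>
      vscale H (a + b) u = vadd H (vscale H a u) (vscale H b u)"
    and scale_scale: "\<And>a b u. u \<in> points H \<Longrightarrow> vscale H a (vscale H b u) = vscale H (a * b) u"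
    and scale_one: "\<And>u. u \<in> points H \<Longrightarrow> vscale H 1 u = u"
    and inner_commute: "\<And>u v. u \<in> points H \<Longrightarrow> v \<in> points H \<Longrightarrow> vinner H u v = vinner H v u"
    and inner_add_left: "\<And>u v w. u \<in> points H \<Longrightarrow> v \<in> points H \<Longrightarrow> w \<in> points H \<Longrightarrow>
      vinner H (vadd H u v) w = vinner H u w + vinner H v w"
    and inner_scale_left: "\<And>a u v. u \<in> points H \<Longrightarrow> v \<in> points H \<Longrightarrow>
      vinner H (vscale H a u) v = a * vinner H u v"
    and inner_ge_zero: "\<And>u. u \<in> points H \<Longrightarrow> 0 \<le> vinner H u u"
    and inner_eq_zero: "\<And>u. u \<in> points H \<Longrightarrow> vinner H u u = 0 \<Longrightarrow> u = vzero H"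
    and complete: "\<And>s :: nat \<Rightarrow> 'h. (\<And>n. s n \<in> points H) \<Longrightarrow>
      (\<And>e. e > 0 \<Longrightarrow> \<exists>N. \<forall>m\<ge>N. \<forall>n\<ge>N. vnorm H (vdiff H (s m) (s n)) < e) \<Longrightarrow>
      \<exists>l\<in>points H. (\<lambda>n. vnorm H (vdiff H (s n) l)) \<longlonglongrightarrow> 0"

lemma hilbert_space_UNIV:
  fixes H :: "'h :: {real_inner, complete_space} inner_product_structure"
  defines "H \<equiv> \<lparr>points = UNIV, vzero = 0, vadd = (+), vscale = (*\<^sub>R), vinner = (\<bullet>)\<rparr>"
  shows "hilbert_space H"
    and "vnorm H u = norm u"
    and "vdiff H u v = u - v"
proof -
  show norm: "vnorm H u = norm u" for u
    by (simp add: H_def vnorm_def norm_eq_sqrt_inner)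
  show diff: "vdiff H u v = u - v" for u v
    by (simp add: H_def vdiff_def)
  have points: "points H = UNIV"
    by (simp add: H_def)
  have complete: "\<exists>l\<in>points H. (\<lambda>n. vnorm H (vdiff H (s n) l)) \<longlonglongrightarrow> 0"
    if "\<And>e. e > 0 \<Longrightarrow> \<exists>N. \<forall>m\<ge>N. \<forall>n\<ge>N. vnorm H (vdiff H (s m) (s n)) < e"
    for s :: "nat \<Rightarrow> 'h"
  proof -
    have "Cauchy s"
      unfolding Cauchy_def dist_norm using that by (simp add: norm diff)
    then obtain l where "s \<longlonglongrightarrow> l"
      using Cauchy_convergent_iff convergent_def by blast
    then have "(\<lambda>n. norm (s n - l)) \<longlonglongrightarrow> 0"
      using LIM_zero tendsto_norm_zero by blast
    then show ?thesis
      by (auto simp: norm diff points)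
  qed
  show "hilbert_space H"
  proof
    fix u assume "u \<in> points H"
    show "\<exists>v\<in>points H. vadd H u v = vzero H"
      by (auto simp: H_def intro: exI[of _ "- u"])
  qed (use complete in \<open>auto simp: H_def algebra_simps inner_commute\<close>)
qed

end

theory Submission
  imports Defs
begin

text \<open>
  On a finite connected network \<open>W\<close>, a dipole is a solution \<open>v\<close> of \<open>\<Delta> v = \<delta>\<^sub>x - \<delta>\<^sub>y\<close>. Green's identity
  turns the equation into the reproducing property \<open>E\<^sub>W(u, v) = u x - u y\<close> for every function \<open>u\<close>,
  where \<open>E\<^sub>W\<close> is the energy form, so that \<open>R\<^sub>W(x, y) = E\<^sub>W(v, v)\<close>. Attach to a function \<open>v\<close> on \<open>W\<close>
  its weighted gradient, the vector with entry \<open>sqrt (c a b / 2) * (v a - v b)\<close> at \<open>(a, b) \<in> W \<times> W\<close>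
  and zero elsewhere. These vectors lie in \<open>\<ell>\<^sup>2(V \<times> V)\<close> and their inner products are energies;
  if \<open>v\<^sub>x\<close> denotes a dipole between \<open>x\<close> and a fixed base vertex \<open>p\<close>, then \<open>v\<^sub>x - v\<^sub>y\<close> is a dipole
  between \<open>x\<close> and \<open>y\<close>, so the gradients of the \<open>v\<^sub>x\<close> embed \<open>(W, R\<^sub>W)\<close>
  (lemma \<open>vnorm_gradient_vector_diff\<close>).

  For \<open>W \<subseteq> W'\<close>, the reproducing property of the dipole \<open>v\<close> on \<open>W\<close>, applied to the restriction of the
  dipole \<open>v'\<close> on \<open>W'\<close>, says that the gradients \<open>g\<close> and \<open>g'\<close> satisfy \<open>\<langle>g, g'\<rangle> = \<langle>g', g'\<rangle>\<close>, hence
  \<open>\<parallel>g - g'\<parallel>\<^sup>2 = R\<^sub>W(x, y) - R\<^sub>W\<^sub>'(x, y)\<close> (lemma \<open>resistance_drop\<close>). This Pythagorean identity does two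
  things. It gives Rayleigh monotonicity, so that along every exhaustion the resistances decrease to
  the infimum over all finite connected subnetworks, which is therefore the free resistance. And it
  shows that along an exhaustion the gradients of the dipoles between \<open>x\<close> and \<open>p\<close> form a Cauchy
  sequence; the limit is \<open>w\<^sub>x\<close>, and the isometries of the finite networks pass to the limit.

  The vertex set is countable because vertices have countably many neighbours and the network is
  connected. So exhaustions exist, and \<open>V \<times> V\<close> can be indexed by \<open>V\<close>, which realises
  \<open>\<ell>\<^sup>2(V \<times> V)\<close> by functions of one vertex.
\<close>

section \<open>The Hilbert space of square-summable functions\<close>

definition ell2 :: "('i \<Rightarrow> real) inner_product_structure" where
  "ell2 = \<lparr>points = {f. (\<lambda>i. (f i)\<^sup>2) summable_on UNIV}, vzero = (\<lambda>_. 0),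
     vadd = (\<lambda>f g i. f i + g i), vscale = (\<lambda>a f i. a * f i),
     vinner = (\<lambda>f g. \<Sum>\<^sub>\<infinity>i. f i * g i)\<rparr>"

lemma ell2_simps:
  "f \<in> points ell2 \<longleftrightarrow> (\<lambda>i. (f i)\<^sup>2) summable_on UNIV"
  "vzero ell2 = (\<lambda>_. 0)"
  "vadd ell2 f g = (\<lambda>i. f i + g i)"
  "vscale ell2 a f = (\<lambda>i. a * f i)"
  "vinner ell2 f g = (\<Sum>\<^sub>\<infinity>i. f i * g i)"
  by (simp_all add: ell2_def)

lemma vdiff_ell2: "vdiff ell2 f g = (\<lambda>i. f i - g i)"
  by (simp add: vdiff_def ell2_simps)

lemma vnorm_ell2: "vnorm ell2 f = sqrt (\<Sum>\<^sub>\<infinity>i. (f i)\<^sup>2)"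
  by (simp add: vnorm_def ell2_simps power2_eq_square)

lemma L2_set_le_vnorm_ell2:
  assumes "f \<in> points ell2" "finite F"
  shows "L2_set f F \<le> vnorm ell2 f"
  unfolding L2_set_def vnorm_ell2
  using assms by (intro real_sqrt_le_mono finite_sum_le_infsum) (simp_all add: ell2_simps)

text \<open>
  Square-summability and norm bounds are both tested on finite index sets, which reduces the triangle
  inequality and completeness to the finite-dimensional quantity \<open>L2_set\<close>.
\<close>

lemma ell2_if_L2_set_bounded:
  assumes "\<And>F. finite F \<Longrightarrow> L2_set f F \<le> b"
  shows "f \<in> points ell2" "vnorm ell2 f \<le> b"
proof -
  have b: "0 \<le> b" using assms[of "{}"] by simp
  have bd: "(\<Sum>i\<in>F. (f i)\<^sup>2) \<le> b\<^sup>2" if "finite F" for F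
    using assms[OF that] b unfolding L2_set_def by (simp add: sqrt_le_D)
  then have "(\<lambda>i. (f i)\<^sup>2) summable_on UNIV"
    by (intro nonneg_bdd_above_summable_on bdd_aboveI[of _ "b\<^sup>2"]) auto
  then show "f \<in> points ell2" by (simp add: ell2_simps)
  show "vnorm ell2 f \<le> b"
    unfolding vnorm_ell2
    using \<open>(\<lambda>i. (f i)\<^sup>2) summable_on UNIV\<close> bd b
    by (intro real_le_lsqrt infsum_le_finite_sums) (auto intro: infsum_nonneg)
qed

lemma ell2_triangle:
  assumes "f \<in> points ell2" "g \<in> points ell2"
  shows "(\<lambda>i. f i + g i) \<in> points ell2"
    and "vnorm ell2 (\<lambda>i. f i + g i) \<le> vnorm ell2 f + vnorm ell2 g"
proof -
  have "L2_set (\<lambda>i. f i + g i) F \<le> vnorm ell2 f + vnorm ell2 g" if "finite F" for F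
    using L2_set_triangle_ineq[of f g F] L2_set_le_vnorm_ell2[OF assms(1) that]
      L2_set_le_vnorm_ell2[OF assms(2) that] by linarith
  from ell2_if_L2_set_bounded[OF this]
  show "(\<lambda>i. f i + g i) \<in> points ell2"
    "vnorm ell2 (\<lambda>i. f i + g i) \<le> vnorm ell2 f + vnorm ell2 g" by blast+
qed

lemma ell2_scale:
  assumes "f \<in> points ell2"
  shows "(\<lambda>i. a * f i) \<in> points ell2"
  using assms by (simp add: ell2_simps power_mult_distrib summable_on_cmult_right)

lemma ell2_diff:
  assumes "f \<in> points ell2" "g \<in> points ell2"
  shows "(\<lambda>i. f i - g i) \<in> points ell2"
  using ell2_triangle(1)[OF assms(1) ell2_scale[OF assms(2), of "-1"]] by simp

lemma ell2_mult_summable: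
  assumes "f \<in> points ell2" "g \<in> points ell2"
  shows "(\<lambda>i. f i * g i) summable_on UNIV"
proof -
  have "(\<lambda>i. ((f i + g i)\<^sup>2 + - (f i)\<^sup>2 + - (g i)\<^sup>2) * (1/2)) summable_on UNIV"
    using assms ell2_triangle(1)[OF assms]
    by (intro summable_on_cmult_left summable_on_add) (auto simp: ell2_simps summable_on_uminus)
  then show ?thesis by (simp add: power2_sum)
qed

text \<open>
  A Cauchy sequence converges at every index. Each bound \<open>\<parallel>s\<^sub>m - s\<^sub>n\<parallel> < e\<close>, restricted to a finite set of
  indices, survives the pointwise limit in one argument, and the resulting bound is uniform in the
  finite set.
\<close>

lemma ell2_complete:
  fixes s :: "nat \<Rightarrow> 'i \<Rightarrow> real"
  assumes s: "\<And>n. s n \<in> points ell2"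
    and cauchy: "\<And>e. e > 0 \<Longrightarrow> \<exists>N. \<forall>m\<ge>N. \<forall>n\<ge>N. vnorm ell2 (vdiff ell2 (s m) (s n)) < e"
  shows "\<exists>l\<in>points ell2. (\<lambda>n. vnorm ell2 (vdiff ell2 (s n) l)) \<longlonglongrightarrow> 0"
proof -
  have diff: "(\<lambda>i. s m i - s n i) \<in> points ell2" for m n
    using s ell2_diff by blast
  have "Cauchy (\<lambda>n. s n i)" for i
  proof (rule metric_CauchyI)
    fix e :: real assume "e > 0"
    then obtain N where N: "\<forall>m\<ge>N. \<forall>n\<ge>N. vnorm ell2 (vdiff ell2 (s m) (s n)) < e"
      using cauchy by blast
    have "dist (s m i) (s n i) < e" if "m \<ge> N" "n \<ge> N" for m n
    proof -
      have "vnorm ell2 (\<lambda>i. s m i - s n i) < e" using N that by (simp add: vdiff_ell2)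
      then show ?thesis
        using L2_set_le_vnorm_ell2[OF diff, of "{i}" m n] by (simp add: dist_real_def)
    qed
    then show "\<exists>M. \<forall>m\<ge>M. \<forall>n\<ge>M. dist (s m i) (s n i) < e" by blast
  qed
  then have "\<exists>x. (\<lambda>n. s n i) \<longlonglongrightarrow> x" for i
    using Cauchy_convergent convergent_def by blast
  then obtain l where l: "\<And>i. (\<lambda>n. s n i) \<longlonglongrightarrow> l i" by metis
  have close: "\<exists>N. \<forall>n\<ge>N. (\<lambda>i. s n i - l i) \<in> points ell2 \<and> vnorm ell2 (\<lambda>i. s n i - l i) \<le> e"
    if e: "e > 0" for e
  proof -
    obtain N where N: "\<forall>m\<ge>N. \<forall>n\<ge>N. vnorm ell2 (vdiff ell2 (s m) (s n)) < e"
      using cauchy[OF e] by blast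
    have "L2_set (\<lambda>i. s n i - l i) F \<le> e" if n: "n \<ge> N" and F: "finite F" for n F
    proof (rule LIMSEQ_le_const2)
      show "(\<lambda>m. L2_set (\<lambda>i. s n i - s m i) F) \<longlonglongrightarrow> L2_set (\<lambda>i. s n i - l i) F"
        unfolding L2_set_def by (intro tendsto_intros l)
      show "\<exists>M. \<forall>m\<ge>M. L2_set (\<lambda>i. s n i - s m i) F \<le> e"
      proof (intro exI allI impI)
        fix m assume "m \<ge> N"
        then have "vnorm ell2 (\<lambda>i. s n i - s m i) < e" using N n by (simp add: vdiff_ell2)
        then show "L2_set (\<lambda>i. s n i - s m i) F \<le> e"
          using L2_set_le_vnorm_ell2[OF diff F, of n m] by linarith
      qed
    qed
    from ell2_if_L2_set_bounded[OF this] show ?thesis by blast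
  qed
  obtain N where "(\<lambda>i. s N i - l i) \<in> points ell2"
    using close[of 1] by auto
  from ell2_diff[OF s[of N] this] have "l \<in> points ell2" by simp
  moreover have "(\<lambda>n. vnorm ell2 (vdiff ell2 (s n) l)) \<longlonglongrightarrow> 0"
  proof (rule LIMSEQ_I)
    fix r :: real assume "r > 0"
    then obtain N where "\<forall>n\<ge>N. vnorm ell2 (\<lambda>i. s n i - l i) \<le> r/2"
      using close[of "r/2"] by auto
    then have "norm (vnorm ell2 (vdiff ell2 (s n) l) - 0) < r" if "n \<ge> N" for n
      using \<open>r > 0\<close> that by (fastforce simp: vdiff_ell2 vnorm_ell2 infsum_nonneg)
    then show "\<exists>N. \<forall>n\<ge>N. norm (vnorm ell2 (vdiff ell2 (s n) l) - 0) < r" by blast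
  qed
  ultimately show ?thesis by blast
qed

lemma hilbert_space_ell2: "hilbert_space (ell2 :: ('i \<Rightarrow> real) inner_product_structure)"
proof
  let ?H = "ell2 :: ('i \<Rightarrow> real) inner_product_structure"
  show "vzero ?H \<in> points ?H"
    by (simp add: ell2_simps)
  fix u v w :: "'i \<Rightarrow> real" and a :: real
  assume u: "u \<in> points ?H"
  show "\<exists>v\<in>points ?H. vadd ?H u v = vzero ?H"
    using ell2_scale[OF u, of "-1"] by (intro bexI[of _ "\<lambda>i. -1 * u i"]) (simp_all add: ell2_simps(2,3))
  show "vscale ?H a u \<in> points ?H"
    using ell2_scale[OF u] by (simp add: ell2_simps(4))
  show "0 \<le> vinner ?H u u"
    by (simp add: ell2_simps infsum_nonneg)
  show "u = vzero ?H" if "vinner ?H u u = 0"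
  proof
    fix i
    have "(u i)\<^sup>2 = 0"
      by (rule nonneg_infsum_le_0D[where A = UNIV])
        (use u that in \<open>auto simp: ell2_simps power2_eq_square\<close>)
    then show "u i = vzero ?H i" by (simp add: ell2_simps)
  qed
  assume v: "v \<in> points ?H"
  show "vadd ?H u v \<in> points ?H"
    using ell2_triangle(1)[OF u v] by (simp add: ell2_simps(3))
  show "vinner ?H (vscale ?H a u) v = a * vinner ?H u v"
    by (simp add: ell2_simps mult.assoc infsum_cmult_right')
  assume w: "w \<in> points ?H"
  show "vinner ?H (vadd ?H u v) w = vinner ?H u w + vinner ?H v w"
    using ell2_mult_summable[OF u w] ell2_mult_summable[OF v w]
    by (simp add: ell2_simps distrib_right infsum_add)
next
  show "\<exists>l\<in>points ell2. (\<lambda>n. vnorm ell2 (vdiff ell2 (s n) l)) \<longlonglongrightarrow> 0"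
    if "\<And>n. s n \<in> points ell2"
      "\<And>e. e > 0 \<Longrightarrow> \<exists>N. \<forall>m\<ge>N. \<forall>n\<ge>N. vnorm ell2 (vdiff ell2 (s m) (s n)) < e"
    for s :: "nat \<Rightarrow> 'i \<Rightarrow> real"
    using ell2_complete that by blast
qed (simp_all add: ell2_simps(2-) algebra_simps)

lemma vnorm_ell2_diff_tendsto:
  assumes "\<And>n. s n \<in> points ell2" "\<And>n. t n \<in> points ell2" "l \<in> points ell2" "m \<in> points ell2"
    and s: "(\<lambda>n. vnorm ell2 (vdiff ell2 (s n) l)) \<longlonglongrightarrow> 0"
    and t: "(\<lambda>n. vnorm ell2 (vdiff ell2 (t n) m)) \<longlonglongrightarrow> 0"
  shows "(\<lambda>n. vnorm ell2 (vdiff ell2 (s n) (t n))) \<longlonglongrightarrow> vnorm ell2 (vdiff ell2 l m)"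
proof -
  note d = ell2_diff
  have swap: "vnorm ell2 (\<lambda>i. f i - g i) = vnorm ell2 (\<lambda>i. g i - f i)" for f g :: "'a \<Rightarrow> real"
    by (simp add: vnorm_ell2 power2_commute)
  have tri: "vnorm ell2 (\<lambda>i. f i - h i) \<le> vnorm ell2 (\<lambda>i. f i - g i) + vnorm ell2 (\<lambda>i. g i - h i)"
    if "f \<in> points ell2" "g \<in> points ell2" "h \<in> points ell2" for f g h :: "'a \<Rightarrow> real"
    using ell2_triangle(2)[OF d[OF that(1,2)] d[OF that(2,3)]] by simp
  have bound: "norm (vnorm ell2 (vdiff ell2 (s n) (t n)) - vnorm ell2 (vdiff ell2 l m))
      \<le> vnorm ell2 (vdiff ell2 (s n) l) + vnorm ell2 (vdiff ell2 (t n) m)" for n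
    using tri[of "s n" l "t n"] tri[of l m "t n"] tri[of l "s n" m] tri[of "s n" "t n" m]
      swap[of "t n" m] swap[of "s n" l] assms(1)[of n] assms(2)[of n] assms(3,4)
    unfolding vdiff_ell2 real_norm_def by linarith
  have sum: "(\<lambda>n. vnorm ell2 (vdiff ell2 (s n) l) + vnorm ell2 (vdiff ell2 (t n) m)) \<longlonglongrightarrow> 0"
    using tendsto_add[OF s t] by simp
  have "(\<lambda>n. vnorm ell2 (vdiff ell2 (s n) (t n)) - vnorm ell2 (vdiff ell2 l m)) \<longlonglongrightarrow> 0"
    by (rule Lim_null_comparison[OF always_eventually sum]) (rule allI, rule bound)
  then show ?thesis by (rule LIM_zero_cancel)
qed

lemma (in hilbert_space) norm_diff_square:
  assumes u: "u \<in> points H" and v: "v \<in> points H"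
  shows "(vnorm H (vdiff H u v))\<^sup>2 = vinner H u u - 2 * vinner H u v + vinner H v v"
proof -
  let ?v = "vscale H (-1) v"
  have v': "?v \<in> points H" and d: "vadd H u ?v \<in> points H"
    using u v by (simp_all add: scale_closed add_closed)
  have "(vnorm H (vdiff H u v))\<^sup>2 = vinner H (vadd H u ?v) (vadd H u ?v)"
    using inner_ge_zero[OF d] by (simp add: vnorm_def vdiff_def)
  also have "\<dots> = vinner H (vadd H u ?v) u + vinner H (vadd H u ?v) ?v"
    using u v' d by (simp add: inner_add_left inner_commute)
  finally show ?thesis
    using u v v' inner_commute[OF u v] inner_commute[OF u v'] inner_commute[OF v v']
    by (simp add: inner_add_left inner_scale_left)
qed

section \<open>Positive definite linear systems\<close>

text \<open>
  Gaussian elimination. Positive definiteness makes the pivot at \<open>p\<close> positive, and it is inherited by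
  the Schur complement \<open>a'\<close> of the pivot: the value of the form of \<open>a'\<close> at \<open>v\<close> is the value of the
  form of \<open>a\<close> at the extension of \<open>v\<close> that satisfies the equation of row \<open>p\<close> with right-hand side zero.
\<close>

lemma posdef_system_solvable:
  fixes a :: "'i \<Rightarrow> 'i \<Rightarrow> real"
  assumes "finite A"
    and "\<And>v. \<exists>x\<in>A. v x \<noteq> 0 \<Longrightarrow> 0 < (\<Sum>x\<in>A. v x * (\<Sum>y\<in>A. a x y * v y))"
  shows "\<exists>v. \<forall>x\<in>A. (\<Sum>y\<in>A. a x y * v y) = b x"
  using assms
proof (induction A arbitrary: a b rule: finite_induct)
  case empty
  then show ?case by simp
next
  case (insert p A)
  let ?d = "a p p"
  define a' where "a' x y = a x y - a x p * a p y / ?d" for x y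
  have upd: "(\<Sum>y\<in>A. a x y * (v(p := t)) y) = (\<Sum>y\<in>A. a x y * v y)" for x v t
    using insert.hyps by (intro sum.cong) auto
  have upd': "(\<Sum>x\<in>A. (v(p := t)) x * f x) = (\<Sum>x\<in>A. v x * f x)" for f v t
    using insert.hyps by (intro sum.cong) auto
  \<comment> \<open>Test the form on the indicator function of \<open>p\<close>.\<close>
  have d: "?d > 0"
  proof -
    have "(\<Sum>y\<in>A. a x y * (if y = p then 1 else 0)) = 0" "(\<Sum>x\<in>A. (if x = p then 1 else 0) * f x) = 0"
      for x and f :: "'i \<Rightarrow> real"
      using insert.hyps by (auto intro!: sum.neutral)
    then show ?thesis
      using insert.prems[of "\<lambda>x. if x = p then 1 else 0"] insert.hyps by simp
  qed
  have a'_sum: "(\<Sum>y\<in>A. a' x y * v y) =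
      (\<Sum>y\<in>A. a x y * v y) - a x p * (\<Sum>y\<in>A. a p y * v y) / ?d" for x v
    by (simp add: a'_def left_diff_distrib sum_subtractf sum_distrib_left sum_divide_distrib mult.assoc)
  have "0 < (\<Sum>x\<in>A. v x * (\<Sum>y\<in>A. a' x y * v y))" if nz: "\<exists>x\<in>A. v x \<noteq> 0" for v
  proof -
    \<comment> \<open>With this value at \<open>p\<close>, row \<open>p\<close> contributes nothing to the form.\<close>
    define t where "t = - (\<Sum>y\<in>A. a p y * v y) / ?d"
    have "\<exists>x\<in>insert p A. (v(p := t)) x \<noteq> 0"
      using nz insert.hyps by auto
    from insert.prems[OF this] have "0 < (\<Sum>x\<in>A. v x * (a x p * t + (\<Sum>y\<in>A. a x y * v y)))"
      using insert.hyps d by (simp add: upd upd' del: fun_upd_apply) (simp add: t_def)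
    also have "\<dots> = (\<Sum>x\<in>A. v x * (\<Sum>y\<in>A. a' x y * v y))"
      by (intro sum.cong) (simp_all add: a'_sum t_def)
    finally show ?thesis .
  qed
  from insert.IH[OF this, of "\<lambda>x. b x - a x p * b p / ?d"]
  obtain v where v: "\<And>x. x \<in> A \<Longrightarrow> (\<Sum>y\<in>A. a' x y * v y) = b x - a x p * b p / ?d"
    by blast
  define t where "t = (b p - (\<Sum>y\<in>A. a p y * v y)) / ?d"
  have "(\<Sum>y\<in>insert p A. a x y * (v(p := t)) y) = b x" if "x \<in> insert p A" for x
  proof (cases "x = p")
    case True
    then show ?thesis using insert.hyps d by (simp add: upd del: fun_upd_apply) (simp add: t_def)
  next
    case False
    then have "x \<in> A" using that by simp
    then show ?thesis
      using v[of x] insert.hyps d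
      by (simp add: upd a'_sum del: fun_upd_apply) (simp add: t_def field_simps)
  qed
  then show ?case by blast
qed

section \<open>Finite networks\<close>

text \<open>
  The factor \<open>1/2\<close> compensates for summing over ordered pairs, in which every edge occurs twice.
\<close>

definition energy :: "'a set \<Rightarrow> ('a \<Rightarrow> 'a \<Rightarrow> real) \<Rightarrow> ('a \<Rightarrow> real) \<Rightarrow> ('a \<Rightarrow> real) \<Rightarrow> real" where
  "energy W c u v = (\<Sum>a\<in>W. \<Sum>b\<in>W. c a b * (u a - u b) * (v a - v b)) / 2"

definition dipole :: "'a set \<Rightarrow> ('a \<Rightarrow> 'a \<Rightarrow> real) \<Rightarrow> 'a \<Rightarrow> 'a \<Rightarrow> ('a \<Rightarrow> real) \<Rightarrow> bool" where
  "dipole W c x y v \<longleftrightarrow> (\<forall>z\<in>W. laplacian W c v z = indicator {x} z - indicator {y} z)"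

lemma energy_commute: "energy W c u v = energy W c v u"
  by (simp add: energy_def mult.commute mult.left_commute)

locale finite_network =
  fixes W :: "'a set" and c :: "'a \<Rightarrow> 'a \<Rightarrow> real"
  assumes finite: "finite W"
    and nonneg: "\<And>x y. x \<in> W \<Longrightarrow> y \<in> W \<Longrightarrow> 0 \<le> c x y"
    and sym: "\<And>x y. x \<in> W \<Longrightarrow> y \<in> W \<Longrightarrow> c x y = c y x"
    and connected: "connected_network W c"
begin

lemma laplacian_eq_sum:
  assumes "x \<in> W"
  shows "laplacian W c v x = (\<Sum>y\<in>W. c x y * (v x - v y))"
proof -
  have fin: "finite (nbrs W c x)" and sub: "nbrs W c x \<subseteq> W"
    using finite by (auto simp: nbrs_def)
  have "laplacian W c v x = (\<Sum>y\<in>nbrs W c x. c x y * (v x - v y))"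
    unfolding laplacian_def by (rule infsum_finite[OF fin])
  also have "\<dots> = (\<Sum>y\<in>W. c x y * (v x - v y))"
    using finite sub nonneg[OF assms] by (intro sum.mono_neutral_left) (force simp: nbrs_def)+
  finally show ?thesis .
qed

text \<open>
  Summation by parts: exchanging the two summation variables pairs the terms \<open>u x\<close> and \<open>- u y\<close> on
  every edge.
\<close>

lemma green: "(\<Sum>x\<in>W. u x * laplacian W c v x) = energy W c u v"
proof -
  let ?S = "\<Sum>x\<in>W. \<Sum>y\<in>W. u x * (c x y * (v x - v y))"
  have L: "(\<Sum>x\<in>W. u x * laplacian W c v x) = ?S"
    by (intro sum.cong) (simp_all add: laplacian_eq_sum sum_distrib_left)
  have "?S = (\<Sum>y\<in>W. \<Sum>x\<in>W. u x * (c x y * (v x - v y)))"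
    by (rule sum.swap)
  also have "\<dots> = (\<Sum>x\<in>W. \<Sum>y\<in>W. - (u y * (c x y * (v x - v y))))"
    by (intro sum.cong) (auto simp: sym algebra_simps)
  finally have swap: "?S = \<dots>" .
  have "2 * ?S = ?S + (\<Sum>x\<in>W. \<Sum>y\<in>W. - (u y * (c x y * (v x - v y))))"
    using swap by linarith
  also have "\<dots> = (\<Sum>x\<in>W. \<Sum>y\<in>W. u x * (c x y * (v x - v y)) - u y * (c x y * (v x - v y)))"
    by (simp add: sum.distrib[symmetric] sum_negf sum_subtractf)
  also have "\<dots> = (\<Sum>x\<in>W. \<Sum>y\<in>W. c x y * (u x - u y) * (v x - v y))"
    by (intro sum.cong) (simp_all add: algebra_simps)
  finally show ?thesis
    by (simp add: L energy_def)
qed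

lemma energy_nonneg: "0 \<le> energy W c v v"
  unfolding energy_def by (auto intro!: sum_nonneg simp: nonneg mult.assoc)

lemma constant_if_energy_zero:
  assumes "energy W c v v = 0" "x \<in> W" "y \<in> W"
  shows "v x = v y"
proof -
  have "(\<Sum>a\<in>W. \<Sum>b\<in>W. c a b * (v a - v b) * (v a - v b)) = 0"
    using assms(1) by (simp add: energy_def)
  then have edge: "v a = v b" if "a \<in> W" "b \<in> nbrs W c a" for a b
    using that finite nonneg
    by (force simp: sum_nonneg_eq_0_iff sum_nonneg mult.assoc nbrs_def)
  have "(x, y) \<in> {(a, b). a \<in> W \<and> b \<in> nbrs W c a}\<^sup>*"
    using connected assms by (auto simp: connected_network_def)
  then show ?thesis
    by (induction rule: rtrancl_induct) (auto simp: edge)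
qed

text \<open>
  Ground one vertex \<open>p\<close>, that is, solve for functions vanishing at \<open>p\<close> and ignore the equation at \<open>p\<close>.
  By Green's identity the quadratic form of this reduced system is the energy, which is positive
  definite since a function of energy zero is constant, hence zero. The equation at \<open>p\<close> then holds
  because all values of a Laplacian add up to zero.
\<close>

lemma poisson_solvable:
  assumes "(\<Sum>x\<in>W. b x) = 0"
  shows "\<exists>v. \<forall>x\<in>W. laplacian W c v x = b x"
proof (cases "W = {}")
  case False
  then obtain p where p: "p \<in> W" by blast
  define A where "A = W - {p}"
  have W: "W = insert p A" "p \<notin> A" "finite A"
    using p finite by (auto simp: A_def)
  define a where "a x y = (if x = y then (\<Sum>z\<in>W. c x z) else 0) - c x y" for x y
  have lap: "(\<Sum>y\<in>A. a x y * v y) = laplacian W c (v(p := 0)) x" if "x \<in> A" for x v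
  proof -
    have "(\<Sum>y\<in>A. a x y * v y) = (\<Sum>z\<in>W. c x z) * v x - (\<Sum>y\<in>A. c x y * v y)"
      using W that by (simp add: a_def left_diff_distrib sum_subtractf if_distrib[of "\<lambda>t. t * _"] cong: if_cong)
    also have "(\<Sum>y\<in>A. c x y * v y) = (\<Sum>y\<in>A. c x y * (v(p := 0)) y)"
      using W by (intro sum.cong) auto
    also have "\<dots> = (\<Sum>y\<in>W. c x y * (v(p := 0)) y)"
      using W by simp
    finally show ?thesis
      using W that
      by (subst laplacian_eq_sum) (auto simp: right_diff_distrib sum_subtractf sum_distrib_right simp del: sum.insert)
  qed
  have "0 < (\<Sum>x\<in>A. v x * (\<Sum>y\<in>A. a x y * v y))" if nz: "\<exists>x\<in>A. v x \<noteq> 0" for v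
  proof -
    have "(\<Sum>x\<in>A. v x * (\<Sum>y\<in>A. a x y * v y)) = (\<Sum>x\<in>A. (v(p := 0)) x * laplacian W c (v(p := 0)) x)"
      using W by (intro sum.cong) (auto simp: lap)
    also have "\<dots> = (\<Sum>x\<in>W. (v(p := 0)) x * laplacian W c (v(p := 0)) x)"
      using W by simp
    also have "\<dots> = energy W c (v(p := 0)) (v(p := 0))"
      by (rule green)
    finally have eq: "(\<Sum>x\<in>A. v x * (\<Sum>y\<in>A. a x y * v y)) = energy W c (v(p := 0)) (v(p := 0))" .
    obtain x where "x \<in> A" "v x \<noteq> 0" using nz by blast
    then have "energy W c (v(p := 0)) (v(p := 0)) \<noteq> 0"
      using constant_if_energy_zero[of "v(p := 0)" x p] W by (auto split: if_splits)
    with energy_nonneg[of "v(p := 0)"] eq show ?thesis by linarith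
  qed
  from posdef_system_solvable[OF W(3) this, of b] obtain v
    where v: "\<And>x. x \<in> A \<Longrightarrow> laplacian W c (v(p := 0)) x = b x"
    using lap by auto
  \<comment> \<open>Test the solution against the constant function, whose energy with anything vanishes.\<close>
  have "(\<Sum>x\<in>W. laplacian W c (v(p := 0)) x) = 0"
    using green[of "\<lambda>_. 1" "v(p := 0)"] by (simp add: energy_def)
  then have "laplacian W c (v(p := 0)) p = b p"
    using assms W v by simp
  with v W have "\<forall>x\<in>W. laplacian W c (v(p := 0)) x = b x" by blast
  then show ?thesis by blast
qed simp

lemma dipole_exists:
  assumes "x \<in> W" "y \<in> W"
  shows "\<exists>v. dipole W c x y v"
  unfolding dipole_def using assms finite
  by (intro poisson_solvable) (simp add: sum_subtractf indicator_def if_distrib)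

text \<open>
  The reproducing property: in the energy form, a dipole represents the evaluation of the potential
  difference between its two poles.
\<close>

lemma energy_dipole:
  assumes "x \<in> W" "y \<in> W" "dipole W c x y v"
  shows "energy W c u v = u x - u y"
proof -
  have "energy W c u v = (\<Sum>z\<in>W. u z * (indicator {x} z - indicator {y} z))"
    using assms(3) by (simp add: green[symmetric] dipole_def)
  also have "\<dots> = u x - u y"
    using assms finite by (simp add: right_diff_distrib sum_subtractf indicator_def)
  finally show ?thesis .
qed

text \<open>
  Two dipoles with the same poles have the same potential difference, since by the reproducing property
  both differences are the energy pairing of the two dipoles, which is symmetric.
\<close>

lemma effective_resistance_dipole:
  assumes "x \<in> W" "y \<in> W" "dipole W c x y v"
  shows "effective_resistance W c x y = v x - v y"
  unfolding effective_resistance_def dipole_def[symmetric]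
proof (rule the_equality)
  show "\<exists>u. dipole W c x y u \<and> v x - v y = u x - u y"
    using assms by blast
  fix r assume "\<exists>u. dipole W c x y u \<and> r = u x - u y"
  then obtain u where u: "dipole W c x y u" "r = u x - u y" by blast
  then show "r = v x - v y"
    using energy_dipole[OF assms, of u] energy_dipole[OF assms(1,2) u(1), of v] energy_commute[of W c u v]
    by simp
qed

lemma dipole_diff:
  assumes "dipole W c x p u" "dipole W c y p v"
  shows "dipole W c x y (\<lambda>z. u z - v z)"
  unfolding dipole_def
proof
  fix z assume z: "z \<in> W"
  have "laplacian W c (\<lambda>z. u z - v z) z = laplacian W c u z - laplacian W c v z"
    using z by (simp add: laplacian_eq_sum sum_subtractf[symmetric] algebra_simps)
  then show "laplacian W c (\<lambda>z. u z - v z) z = indicator {x} z - indicator {y} z"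
    using assms z by (simp add: dipole_def)
qed

end

section \<open>Gradients of potentials as square-summable functions\<close>

text \<open>
  The map \<open>d\<close> enumerates the ordered pairs of vertices by the index set \<open>I\<close>. In the main construction
  \<open>I\<close> is the vertex set itself, so that gradients become functions of one vertex.
\<close>

definition gradient_vector ::
    "('i \<Rightarrow> 'a \<times> 'a) \<Rightarrow> 'i set \<Rightarrow> 'a set \<Rightarrow> ('a \<Rightarrow> 'a \<Rightarrow> real) \<Rightarrow> ('a \<Rightarrow> real) \<Rightarrow> 'i \<Rightarrow> real" where
  "gradient_vector d I W c v i = (if i \<in> I \<and> d i \<in> W \<times> W
     then sqrt (c (fst (d i)) (snd (d i)) / 2) * (v (fst (d i)) - v (snd (d i))) else 0)"

context finite_network
begin

text \<open>
  On pairs outside \<open>W \<times> W\<close> the first factor vanishes, so even when the second gradient is taken on a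
  larger set only the edges of \<open>W\<close> contribute.
\<close>

lemma gradient_vector_product_sum:
  assumes d: "bij_betw d I (V \<times> V)" and "W \<subseteq> W'" "W \<subseteq> V"
  shows "((\<lambda>i. gradient_vector d I W c u i * gradient_vector d I W' c v i) has_sum energy W c u v) UNIV"
proof -
  define J where "J = {i \<in> I. d i \<in> W \<times> W}"
  have sub: "W \<times> W \<subseteq> V \<times> V"
    using assms(3) by blast
  have "d ` J = W \<times> W"
  proof (intro set_eqI iffI)
    fix e assume e: "e \<in> W \<times> W"
    with sub have "e \<in> d ` I" using bij_betw_imp_surj_on[OF d] by blast
    then obtain i where i: "i \<in> I" "e = d i" by blast
    with e have "i \<in> J" unfolding J_def by simp
    with i show "e \<in> d ` J" by simp
  next
    fix e assume "e \<in> d ` J"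
    then show "e \<in> W \<times> W" unfolding J_def by fast
  qed
  moreover have "J \<subseteq> I" unfolding J_def by fast
  ultimately have bij: "bij_betw d J (W \<times> W)"
    using bij_betw_subset[OF d] by metis
  have J: "finite J"
    using bij_betw_finite[OF bij] finite by simp
  let ?f = "\<lambda>(a, b). c a b / 2 * (u a - u b) * (v a - v b)"
  have "(\<Sum>i\<in>J. gradient_vector d I W c u i * gradient_vector d I W' c v i) = (\<Sum>i\<in>J. ?f (d i))"
  proof (intro sum.cong refl)
    fix i assume i: "i \<in> J"
    obtain a b where ab: "d i = (a, b)" by fastforce
    define q where "q = sqrt (c a b / 2)"
    have W: "a \<in> W" "b \<in> W" "a \<in> W'" "b \<in> W'" "i \<in> I"
      using i ab assms(2) by (auto simp: J_def)
    then have "gradient_vector d I W c u i = q * (u a - u b)" "gradient_vector d I W' c v i = q * (v a - v b)"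
      by (simp_all add: gradient_vector_def ab q_def)
    moreover have "q * q = c a b / 2"
      using nonneg[of a b] W by (simp add: q_def)
    then have "(q * (u a - u b)) * (q * (v a - v b)) = c a b / 2 * (u a - u b) * (v a - v b)"
      by (simp only: mult_ac flip: \<open>q * q = c a b / 2\<close>)
    ultimately show "gradient_vector d I W c u i * gradient_vector d I W' c v i = ?f (d i)"
      by (simp only: ab prod.case)
  qed
  also have "\<dots> = (\<Sum>e\<in>W \<times> W. ?f e)"
    by (rule sum.reindex_bij_betw[OF bij])
  also have "\<dots> = energy W c u v"
    by (simp add: energy_def sum.cartesian_product sum_divide_distrib case_prod_unfold)
  finally have "((\<lambda>i. gradient_vector d I W c u i * gradient_vector d I W' c v i) has_sum energy W c u v) J"
    using J by (simp add: has_sum_finiteI)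
  then show ?thesis
    by (rule has_sum_cong_neutral[THEN iffD1, rotated -1]) (auto simp: gradient_vector_def J_def)
qed

lemma gradient_vector_in_ell2:
  assumes "bij_betw d I (V \<times> V)" "W \<subseteq> V"
  shows "gradient_vector d I W c v \<in> points ell2"
  using gradient_vector_product_sum[OF assms(1) subset_refl assms(2), of v v]
  by (auto simp: ell2_simps power2_eq_square summable_on_def)

lemma vinner_gradient_vector:
  assumes "bij_betw d I (V \<times> V)" "W \<subseteq> W'" "W \<subseteq> V"
  shows "vinner ell2 (gradient_vector d I W c u) (gradient_vector d I W' c v) = energy W c u v"
  using gradient_vector_product_sum[OF assms] by (simp add: ell2_simps infsumI)

text \<open>
  The finite form of the embedding: all dipoles have the common pole \<open>p\<close>, and the gradient is linear, so
  the difference vector is the gradient of a dipole between \<open>x\<close> and \<open>y\<close>.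
\<close>

lemma vnorm_gradient_vector_diff:
  assumes d: "bij_betw d I (V \<times> V)" and W: "W \<subseteq> V"
    and x: "x \<in> W" "y \<in> W" "p \<in> W"
    and u: "dipole W c x p u" and v: "dipole W c y p v"
  shows "vnorm ell2 (vdiff ell2 (gradient_vector d I W c u) (gradient_vector d I W c v))
    = sqrt (effective_resistance W c x y)"
proof -
  let ?w = "\<lambda>z. u z - v z"
  have "vdiff ell2 (gradient_vector d I W c u) (gradient_vector d I W c v) = gradient_vector d I W c ?w"
    by (auto simp: vdiff_ell2 gradient_vector_def algebra_simps)
  moreover have "energy W c ?w ?w = effective_resistance W c x y"
    using energy_dipole[OF x(1,2) dipole_diff[OF u v], of ?w]
      effective_resistance_dipole[OF x(1,2) dipole_diff[OF u v]] by simp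
  ultimately show ?thesis
    using vinner_gradient_vector[OF d subset_refl W, of ?w ?w] by (simp add: vnorm_def)
qed

lemma effective_resistance_nonneg:
  assumes "x \<in> W" "y \<in> W"
  shows "0 \<le> effective_resistance W c x y"
proof -
  obtain v where v: "dipole W c x y v" using dipole_exists[OF assms] by blast
  show ?thesis
    using energy_nonneg[of v] energy_dipole[OF assms v, of v] effective_resistance_dipole[OF assms v] by simp
qed

text \<open>
  The squared norms of the two gradients are the two resistances. Their inner product only sees the
  edges of \<open>W\<close>, so it is \<open>E\<^sub>W(v, v')\<close>, and as \<open>v\<close> is a dipole on \<open>W\<close> it equals
  \<open>v' x - v' y = R\<^sub>W\<^sub>'(x, y)\<close>.
\<close>

lemma resistance_drop:
  assumes W': "finite_network W' c" "W \<subseteq> W'" "W' \<subseteq> V" and d: "bij_betw d I (V \<times> V)"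
    and x: "x \<in> W" "y \<in> W" and v: "dipole W c x y v" and v': "dipole W' c x y v'"
  shows "(vnorm ell2 (vdiff ell2 (gradient_vector d I W c v) (gradient_vector d I W' c v')))\<^sup>2
    = effective_resistance W c x y - effective_resistance W' c x y"
proof -
  interpret W': finite_network W' c by fact
  interpret hilbert_space "ell2 :: ('c \<Rightarrow> real) inner_product_structure" by (rule hilbert_space_ell2)
  have W: "W \<subseteq> V" and x': "x \<in> W'" "y \<in> W'" using W' x by auto
  have "energy W c v v = effective_resistance W c x y"
    using energy_dipole[OF x v, of v] effective_resistance_dipole[OF x v] by simp
  moreover have "energy W' c v' v' = effective_resistance W' c x y"
    using W'.energy_dipole[OF x' v', of v'] W'.effective_resistance_dipole[OF x' v'] by simp
  moreover have "energy W c v v' = effective_resistance W' c x y"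
    using energy_dipole[OF x v, of v'] W'.effective_resistance_dipole[OF x' v'] energy_commute[of W c v v'] by simp
  ultimately show ?thesis
    using vinner_gradient_vector[OF d subset_refl W, of v v] vinner_gradient_vector[OF d W'(2) W, of v v']
      W'.vinner_gradient_vector[OF d subset_refl W'(3), of v' v']
      norm_diff_square[OF gradient_vector_in_ell2[OF d W, of v] W'.gradient_vector_in_ell2[OF d W'(3), of v']]
    by simp
qed

lemma effective_resistance_antimono:
  assumes W': "finite_network W' c" "W \<subseteq> W'" and x: "x \<in> W" "y \<in> W"
  shows "effective_resistance W' c x y \<le> effective_resistance W c x y"
proof -
  obtain v where v: "dipole W c x y v" using dipole_exists[OF x] by blast
  obtain v' where v': "dipole W' c x y v'"
    using finite_network.dipole_exists[OF W'(1)] x W'(2) by blast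
  \<comment> \<open>For a single pair of networks, the pairs of vertices can index themselves.\<close>
  have "bij_betw id (W' \<times> W') (W' \<times> W')" by simp
  from resistance_drop[OF W' subset_refl this x v v'] show ?thesis
    by (metis diff_ge_0_iff_ge zero_le_power2)
qed

end

section \<open>Exhaustions and the free resistance\<close>

lemma connected_network_Un:
  assumes "connected_network A c" "connected_network B c" "p \<in> A" "p \<in> B"
  shows "connected_network (A \<union> B) c"
proof -
  let ?E = "\<lambda>W. {(a, b). a \<in> W \<and> b \<in> nbrs W c a}"
  have "?E A \<subseteq> ?E (A \<union> B)" "?E B \<subseteq> ?E (A \<union> B)"
    by (auto simp: nbrs_def)
  then have sub: "(?E A)\<^sup>* \<subseteq> (?E (A \<union> B))\<^sup>*" "(?E B)\<^sup>* \<subseteq> (?E (A \<union> B))\<^sup>*"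
    by (simp_all add: rtrancl_mono)
  have "(x, p) \<in> (?E (A \<union> B))\<^sup>*" "(p, x) \<in> (?E (A \<union> B))\<^sup>*" if "x \<in> A \<union> B" for x
    using that assms sub unfolding connected_network_def by blast+
  then show ?thesis
    unfolding connected_network_def by (meson rtrancl_trans)
qed

context resistance_network
begin

lemma finite_subnetwork:
  assumes "W \<subseteq> V" "finite W" "connected_network W c"
  shows "finite_network W c"
  using assms by unfold_locales (auto intro: conductance_nonneg conductance_sym)

lemma finite_connected_superset:
  assumes "p \<in> V" "x \<in> V"
  shows "\<exists>W. finite W \<and> W \<subseteq> V \<and> connected_network W c \<and> p \<in> W \<and> x \<in> W"
proof -
  have "(p, x) \<in> {(a, b). a \<in> V \<and> b \<in> nbrs V c a}\<^sup>*"
    using connected assms by (auto simp: connected_network_def)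
  then show ?thesis
  proof (induction rule: rtrancl_induct)
    case base
    show ?case using assms by (intro exI[of _ "{p}"]) (auto simp: connected_network_def)
  next
    case (step a b)
    then obtain W where W: "finite W" "W \<subseteq> V" "connected_network W c" "p \<in> W" "a \<in> W" by blast
    have ab: "a \<in> V" "b \<in> V" "c a b > 0" "c b a > 0"
      using step.hyps(2) conductance_sym by (auto simp: nbrs_def)
    have "connected_network {a, b} c"
      using ab by (auto simp: connected_network_def nbrs_def intro!: r_into_rtrancl)
    then have "connected_network (W \<union> {a, b}) c"
      using W by (intro connected_network_Un[where p = a]) auto
    then show ?case
      using W ab by (intro exI[of _ "W \<union> {a, b}"]) auto
  qed
qed

lemma countable_vertices: "countable V"
proof (cases "V = {}")
  case False
  then obtain p where p: "p \<in> V" by blast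
  let ?E = "{(a, b). a \<in> V \<and> b \<in> nbrs V c a}"
  have nb: "countable (nbrs V c a)" if "a \<in> V" for a
  proof -
    have "{b \<in> nbrs V c a. c a b \<noteq> 0} = nbrs V c a" by (auto simp: nbrs_def)
    then show ?thesis
      using summable_countable_real[OF conductance_summable[OF that]] by simp
  qed
  have "countable (?E `` {a})" for a
    using nb[of a] by (cases "a \<in> V") (auto simp: Image_def)
  then have "countable (?E `` Y)" if "countable Y" for Y
    using countable_UN[OF that, of "\<lambda>a. ?E `` {a}"]
    by (subst Image_eq_UN) simp
  then have "countable (?E\<^sup>* `` {p})"
    by (rule countable_rtrancl) (auto intro: countable_finite)
  moreover have "V \<subseteq> ?E\<^sup>* `` {p}"
    using connected p by (auto simp: connected_network_def)
  ultimately show ?thesis using countable_subset by blast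
qed simp

text \<open>
  Enumerate the vertices and take finite unions of finite connected sets that join the enumerated
  vertices to \<open>p\<close>; the common vertex \<open>p\<close> keeps the unions connected.
\<close>

lemma exhaustion_exists:
  assumes p: "p \<in> V"
  shows "\<exists>G. exhaustion V c G \<and> (\<forall>k. p \<in> G k)"
proof -
  define f where "f = from_nat_into V"
  have f: "range f = V"
    unfolding f_def using p countable_vertices by (intro range_from_nat_into) auto
  then have "\<exists>W. finite W \<and> W \<subseteq> V \<and> connected_network W c \<and> p \<in> W \<and> f n \<in> W" for n
    using finite_connected_superset[OF p] by blast
  then obtain P where P: "\<And>n. finite (P n)" "\<And>n. P n \<subseteq> V" "\<And>n. connected_network (P n) c"
      "\<And>n. p \<in> P n" "\<And>n. f n \<in> P n"
    by metis
  define G where "G k = (\<Union>n\<le>k. P n)" for k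
  have pG: "p \<in> G k" for k
    using P(4) by (auto simp: G_def)
  have "connected_network (G k) c" for k
  proof (induction k)
    case 0
    show ?case using P(3) by (simp add: G_def)
  next
    case (Suc k)
    have "G (Suc k) = G k \<union> P (Suc k)" by (auto simp: G_def atMost_Suc)
    then show ?case using connected_network_Un[OF Suc P(3) pG P(4)] by simp
  qed
  moreover have "finite (G k)" for k using P(1) by (simp add: G_def)
  moreover have "incseq G" by (force simp: G_def incseq_def)
  moreover have "(\<Union>k. G k) = V"
  proof
    show "V \<subseteq> (\<Union>k. G k)" using f P(5) by (force simp: G_def)
    show "(\<Union>k. G k) \<subseteq> V" using P(2) by (auto simp: G_def)
  qed
  ultimately show ?thesis using pG unfolding exhaustion_def by blast
qed

lemma exhaustion_subnetwork:
  assumes "exhaustion V c G"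
  shows "finite_network (G k) c" "G k \<subseteq> V"
proof -
  show sub: "G k \<subseteq> V"
    using assms UN_upper[of k UNIV G] by (simp add: exhaustion_def)
  show "finite_network (G k) c"
    using assms finite_subnetwork[OF sub] by (simp add: exhaustion_def)
qed

lemma exhaustion_mono:
  assumes "exhaustion V c G" "m \<le> n"
  shows "G m \<subseteq> G n"
  using assms by (simp add: exhaustion_def incseq_def)

lemma exhaustion_eventually_contains:
  assumes G: "exhaustion V c G" and "finite W" "W \<subseteq> V"
  shows "\<exists>N. \<forall>k\<ge>N. W \<subseteq> G k"
  using assms(2,3)
proof (induction W rule: finite_induct)
  case (insert x W)
  have "x \<in> (\<Union>k. G k)"
    using insert.prems G by (simp add: exhaustion_def)
  then obtain M where M: "x \<in> G M" by blast
  obtain N where N: "\<forall>k\<ge>N. W \<subseteq> G k"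
    using insert by blast
  have "insert x W \<subseteq> G k" if "k \<ge> max N M" for k
    using N M that exhaustion_mono[OF G, of M k] by auto
  then show ?case by blast
qed auto

text \<open>
  The limit is described without reference to the exhaustion: every finite connected set is
  eventually contained in \<open>G k\<close>, and from then on monotonicity bounds the resistance by that of the set.
  This is what makes the free resistance well defined.
\<close>

lemma effective_resistance_tendsto_Inf:
  assumes G: "exhaustion V c G" and x: "\<And>k. x \<in> G k \<and> y \<in> G k"
  shows "(\<lambda>k. effective_resistance (G k) c x y) \<longlonglongrightarrow>
    Inf ((\<lambda>W. effective_resistance W c x y) `
      {W. finite W \<and> W \<subseteq> V \<and> connected_network W c \<and> x \<in> W \<and> y \<in> W})"
    (is "?R \<longlonglongrightarrow> Inf (?r ` ?S)")
proof (rule LIMSEQ_I)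
  fix e :: real assume e: "e > 0"
  have GS: "G k \<in> ?S" for k
    using x G exhaustion_subnetwork(2)[OF G] unfolding exhaustion_def by simp
  have bdd: "bdd_below (?r ` ?S)"
    using finite_network.effective_resistance_nonneg[OF finite_subnetwork]
    by (intro bdd_belowI[of _ 0]) auto
  obtain W where W: "W \<in> ?S" "?r W < Inf (?r ` ?S) + e"
    using cInf_lessD[of "?r ` ?S" "Inf (?r ` ?S) + e"] GS e by auto
  obtain N where N: "\<forall>k\<ge>N. W \<subseteq> G k"
    using exhaustion_eventually_contains[OF G] W by blast
  have "norm (?r (G k) - Inf (?r ` ?S)) < e" if "k \<ge> N" for k
  proof -
    have "Inf (?r ` ?S) \<le> ?r (G k)"
      using bdd GS by (intro cInf_lower) auto
    moreover have "?r (G k) \<le> ?r W"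
      using W N that finite_network.effective_resistance_antimono[OF finite_subnetwork exhaustion_subnetwork(1)[OF G]]
      by auto
    ultimately show ?thesis using W by simp
  qed
  then show "\<exists>N. \<forall>k\<ge>N. norm (?r (G k) - Inf (?r ` ?S)) < e" by blast
qed

lemma exhaustion_shift:
  assumes "exhaustion V c G"
  shows "exhaustion V c (\<lambda>k. G (k + N))"
proof -
  have inc: "G k \<subseteq> G (k + N)" for k
    by (rule exhaustion_mono[OF assms]) simp
  have "(\<Union>k. G (k + N)) = (\<Union>k. G k)"
  proof
    show "(\<Union>k. G k) \<subseteq> (\<Union>k. G (k + N))" using inc by blast
  qed blast
  moreover have "incseq (\<lambda>k. G (k + N))"
    by (intro monoI exhaustion_mono[OF assms]) simp
  ultimately show ?thesis
    using assms by (simp add: exhaustion_def)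
qed

lemma effective_resistance_tendsto_free_resistance:
  assumes G: "exhaustion V c G" and x: "x \<in> V" "y \<in> V"
  shows "(\<lambda>k. effective_resistance (G k) c x y) \<longlonglongrightarrow> free_resistance V c x y"
proof -
  obtain N where N: "\<forall>k\<ge>N. {x, y} \<subseteq> G k"
    using exhaustion_eventually_contains[OF G, of "{x, y}"] x by auto
  define G' where "G' = (\<lambda>k. G (k + N))"
  have G': "exhaustion V c G'" "\<And>k. x \<in> G' k \<and> y \<in> G' k"
    using exhaustion_shift[OF G, of N] N by (auto simp: G'_def)
  have "free_resistance V c x y = Inf ((\<lambda>W. effective_resistance W c x y) `
      {W. finite W \<and> W \<subseteq> V \<and> connected_network W c \<and> x \<in> W \<and> y \<in> W})"
    unfolding free_resistance_def
  proof (rule the_equality)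
    fix r
    assume "\<forall>G. exhaustion V c G \<and> (\<forall>k. x \<in> G k \<and> y \<in> G k)
      \<longrightarrow> (\<lambda>k. effective_resistance (G k) c x y) \<longlonglongrightarrow> r"
    with G' have "(\<lambda>k. effective_resistance (G' k) c x y) \<longlonglongrightarrow> r" by blast
    then show "r = Inf ((\<lambda>W. effective_resistance W c x y) `
      {W. finite W \<and> W \<subseteq> V \<and> connected_network W c \<and> x \<in> W \<and> y \<in> W})"
      using effective_resistance_tendsto_Inf[OF G'] LIMSEQ_unique by blast
  qed (use effective_resistance_tendsto_Inf in blast)
  then have "(\<lambda>k. effective_resistance (G' k) c x y) \<longlonglongrightarrow> free_resistance V c x y"
    using effective_resistance_tendsto_Inf[OF G'] by simp
  then show ?thesis
    unfolding G'_def by (rule LIMSEQ_offset)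
qed

end

section \<open>The embedding\<close>

lemma countable_infinite_square_bij:
  assumes "countable A" "infinite A"
  shows "\<exists>d. bij_betw d A (A \<times> A)"
proof -
  have "infinite (A \<times> A)"
    using assms by (auto simp: finite_cartesian_product_iff)
  then have "bij_betw (to_nat_on (A \<times> A)) (A \<times> A) UNIV" "bij_betw (to_nat_on A) A UNIV"
    using assms by (simp_all add: to_nat_on_infinite)
  then show ?thesis
    by (meson bij_betw_trans bij_betw_inv_into)
qed

theorem theorem5p4:
  fixes V :: "'a set" and c :: "'a \<Rightarrow> 'a \<Rightarrow> real"
  assumes "resistance_network V c" and "infinite V"
  shows "\<exists>(H :: ('a \<Rightarrow> real) inner_product_structure) (w :: 'a \<Rightarrow> ('a \<Rightarrow> real)).
    hilbert_space H \<and> (\<forall>x\<in>V. w x \<in> points H) \<and>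
    (\<forall>x\<in>V. \<forall>y\<in>V. sqrt (free_resistance V c x y) = vnorm H (vdiff H (w x) (w y)))"
proof -
  interpret resistance_network V c by fact
  obtain p where p: "p \<in> V" using \<open>infinite V\<close> by fastforce
  obtain G where G: "exhaustion V c G" and pG: "\<And>k. p \<in> G k"
    using exhaustion_exists[OF p] by blast
  obtain d where d: "bij_betw d V (V \<times> V)"
    using countable_infinite_square_bij[OF countable_vertices \<open>infinite V\<close>] by blast
  have fin: "finite_network (G k) c" and sub: "G k \<subseteq> V" for k
    using exhaustion_subnetwork[OF G] by auto
  define u where "u k x = (SOME v. dipole (G k) c x p v)" for k x
  have u: "dipole (G k) c x p (u k x)" if "x \<in> G k" for k x
    unfolding u_def using finite_network.dipole_exists[OF fin that pG] by (rule someI_ex)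
  define s where "s x k = gradient_vector d V (G k) c (u k x)" for x k
  have s: "s x k \<in> points ell2" for x k
    unfolding s_def by (rule finite_network.gradient_vector_in_ell2[OF fin d sub])
  have "\<exists>l\<in>points ell2. (\<lambda>k. vnorm ell2 (vdiff ell2 (s x k) l)) \<longlonglongrightarrow> 0" if x: "x \<in> V" for x
  proof (rule ell2_complete)
    fix e :: real assume e: "e > 0"
    let ?R = "\<lambda>k. effective_resistance (G k) c x p"
    obtain K where K: "\<forall>k\<ge>K. {x} \<subseteq> G k"
      using exhaustion_eventually_contains[OF G, of "{x}"] x by auto
    have "Cauchy ?R"
      using effective_resistance_tendsto_free_resistance[OF G x p] by (rule LIMSEQ_imp_Cauchy)
    then obtain M where M: "\<forall>m\<ge>M. \<forall>n\<ge>M. dist (?R m) (?R n) < e\<^sup>2"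
      using e metric_CauchyD[of ?R "e\<^sup>2"] by auto
    \<comment> \<open>By the Pythagorean identity, convergence of the resistances makes the gradients Cauchy.\<close>
    have le: "vnorm ell2 (vdiff ell2 (s x m) (s x n)) < e" if "max K M \<le> m" "m \<le> n" for m n
    proof -
      have mn: "G m \<subseteq> G n" "x \<in> G m" "x \<in> G n"
        using G K that by (auto simp: exhaustion_def incseq_def)
      have "(vnorm ell2 (vdiff ell2 (s x m) (s x n)))\<^sup>2 = ?R m - ?R n"
        unfolding s_def using mn u pG
        by (intro finite_network.resistance_drop[OF fin fin mn(1) sub d]) auto
      also have "\<dots> < e\<^sup>2"
        using M[rule_format, of m n] that by (simp add: dist_real_def)
      finally show ?thesis
        by (rule power2_less_imp_less) (use e in simp)
    qed
    have "vnorm ell2 (vdiff ell2 (s x m) (s x n)) = vnorm ell2 (vdiff ell2 (s x n) (s x m))" for m n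
      by (simp add: vdiff_ell2 vnorm_ell2 power2_commute)
    then have "vnorm ell2 (vdiff ell2 (s x m) (s x n)) < e" if "max K M \<le> m" "max K M \<le> n" for m n
      using le[of m n] le[of n m] that by (cases "m \<le> n") auto
    then show "\<exists>N. \<forall>m\<ge>N. \<forall>n\<ge>N. vnorm ell2 (vdiff ell2 (s x m) (s x n)) < e" by blast
  qed (rule s)
  then obtain w where w: "\<And>x. x \<in> V \<Longrightarrow> w x \<in> points ell2"
    and lim: "\<And>x. x \<in> V \<Longrightarrow> (\<lambda>k. vnorm ell2 (vdiff ell2 (s x k) (w x))) \<longlonglongrightarrow> 0"
    by metis
  have "sqrt (free_resistance V c x y) = vnorm ell2 (vdiff ell2 (w x) (w y))"
    if x: "x \<in> V" and y: "y \<in> V" for x y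
  proof -
    obtain K where K: "\<forall>k\<ge>K. {x, y} \<subseteq> G k"
      using exhaustion_eventually_contains[OF G, of "{x, y}"] x y by auto
    have "\<forall>\<^sub>F k in sequentially. vnorm ell2 (vdiff ell2 (s x k) (s y k))
        = sqrt (effective_resistance (G k) c x y)"
      using eventually_ge_at_top[of K]
    proof eventually_elim
      case (elim k)
      then have "x \<in> G k" "y \<in> G k" using K by auto
      then show ?case
        unfolding s_def
        using finite_network.vnorm_gradient_vector_diff[OF fin d sub _ _ pG u u] by blast
    qed
    moreover have "(\<lambda>k. sqrt (effective_resistance (G k) c x y)) \<longlonglongrightarrow> sqrt (free_resistance V c x y)"
      using effective_resistance_tendsto_free_resistance[OF G x y] by (rule tendsto_real_sqrt)
    ultimately have "(\<lambda>k. vnorm ell2 (vdiff ell2 (s x k) (s y k))) \<longlonglongrightarrow> sqrt (free_resistance V c x y)"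
      by (simp add: tendsto_cong)
    moreover have "(\<lambda>k. vnorm ell2 (vdiff ell2 (s x k) (s y k))) \<longlonglongrightarrow> vnorm ell2 (vdiff ell2 (w x) (w y))"
      by (rule vnorm_ell2_diff_tendsto[OF s s w[OF x] w[OF y] lim[OF x] lim[OF y]])
    ultimately show ?thesis using LIMSEQ_unique by blast
  qed
  then show ?thesis
    using hilbert_space_ell2 w by blast
qed

end
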